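(* If the sequence $(a_n)_{n \ge 1}$ of non-negative real numbers satisfies $\sum_{n=1}^\infty a_n^2 = \infty$ and $a_n \to 0$ as $n \to \infty$, then the associated Rademacher random walk is topologically recurrent.
   Context: Let $\epsilon_1, \epsilon_2, \dots$ be independent Rademacher random variables, taking values $\pm 1$ each with probability $1/2$. The Rademacher random walk associated with a deterministic sequence $(a_n)_{n\ge1}$ of non-negative reals is $(X_n)_{n\ge 0}$, $X_n = \sum_{k=1}^n \epsilon_k a_k$. The walk is topologically recurrent if its range $\{X_n : n \ge 0\}$ is almost surely dense in $\mathbb{R}$. *)

theory Defs
  imports "HOL-Probability.Probability"
begin

text \<open>All sequences are indexed from 1; the values at index 0 are irrelevant.
  Measurability of the variables is part of \<^const>\<open>prob_space.indep_vars\<close>.\<close>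

definition rademacher_sequence :: "'w measure \<Rightarrow> (nat \<Rightarrow> 'w \<Rightarrow> real) \<Rightarrow> bool" where
  "rademacher_sequence M \<epsilon> \<longleftrightarrow>
     prob_space.indep_vars M (\<lambda>_. borel) \<epsilon> {1..} \<and>
     (\<forall>n\<ge>1. measure M {\<omega> \<in> space M. \<epsilon> n \<omega> = 1} = 1 / 2 \<and>
             measure M {\<omega> \<in> space M. \<epsilon> n \<omega> = -1} = 1 / 2)"

definition rademacher_walk ::
    "(nat \<Rightarrow> 'w \<Rightarrow> real) \<Rightarrow> (nat \<Rightarrow> real) \<Rightarrow> nat \<Rightarrow> 'w \<Rightarrow> real" where
  "rademacher_walk \<epsilon> a n \<omega> = (\<Sum>k=1..n. \<epsilon> k \<omega> * a k)"

definition topologically_recurrent :: "'w measure \<Rightarrow> (nat \<Rightarrow> 'w \<Rightarrow> real) \<Rightarrow> bool" where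
  "topologically_recurrent M X \<longleftrightarrow> (AE \<omega> in M. closure (range (\<lambda>n. X n \<omega>)) = UNIV)"

end

theory Submission
  imports Defs
begin

text \<open>
  Two facts decide the matter. A real sequence whose increments tend to \<open>0\<close> and which is unbounded
  both above and below has dense range, because it keeps crossing every level with ever smaller
  jumps (\<open>closure_range_eq_UNIV_if_small_steps\<close>). Since \<open>a n \<longlonglongrightarrow> 0\<close>, it is thus enough that the walk is
  almost surely unbounded above; applying this to the negated signs gives unboundedness below.

  Boundedness above of the partial sums of independent variables is a tail event, so by
  Kolmogorov's law it has probability \<open>0\<close> or \<open>1\<close> (\<open>AE_bdd_above_partial_sums_0_1\<close>). To exclude \<open>1\<close>
  it suffices that the walk exceeds every level with probability bounded away from \<open>0\<close>. Here the
  moments do the work: with \<open>s\<^sup>2 = (\<Sum>i<n. (b i)\<^sup>2)\<close>, the sum of the \<open>\<plusminus>b i\<close> has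
  moments \<open>0\<close>, \<open>s\<^sup>2\<close>, \<open>0\<close> and at most \<open>3 * s ^ 4\<close>, like a centred Gaussian of
  variance \<open>s\<^sup>2\<close>. A quartic test polynomial turns this into a bound
  \<open>1/128\<close> for the probability that the sum is at least \<open>s / 12\<close> (\<open>prob_S_ge\<close>), and \<open>s\<close> tends to
  infinity. This replaces the central limit theorem by elementary algebra.
\<close>

section \<open>A zero-one law for boundedness of partial sums\<close>

lemma bdd_above_partial_sums_iff_tail:
  fixes z :: "nat \<Rightarrow> real"
  shows "bdd_above (range (\<lambda>n. \<Sum>i<n. z i)) \<longleftrightarrow> (\<exists>K::nat. \<forall>n. (\<Sum>i=m..<n. z i) \<le> real K)"
    (is "?L \<longleftrightarrow> ?R")
proof
  have split: "(\<Sum>i<n. z i) = (\<Sum>i<m. z i) + (\<Sum>i=m..<n. z i)" if "m \<le> n" for n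
    using sum.atLeastLessThan_concat[of 0 m n z] that by (simp add: lessThan_atLeast0)
  {
    assume ?L
    then obtain C where C: "\<And>n. (\<Sum>i<n. z i) \<le> C" by (auto simp: bdd_above_def)
    obtain K :: nat where K: "max 0 (C - (\<Sum>i<m. z i)) \<le> real K" using real_arch_simple by blast
    have "(\<Sum>i=m..<n. z i) \<le> real K" for n
      using C[of n] K split[of n] by (cases "m \<le> n") auto
    then show ?R by blast
  next
    assume ?R
    then obtain K :: nat where K: "\<And>n. (\<Sum>i=m..<n. z i) \<le> real K" by blast
    have "(\<Sum>i<n. z i) \<le> max (Max ((\<lambda>n. \<Sum>i<n. z i) ` {..m})) ((\<Sum>i<m. z i) + real K)" for n
    proof (cases "m \<le> n")
      case True
      then show ?thesis using K[of n] split[of n] by simp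
    next
      case False
      then show ?thesis by (intro max.coboundedI1 Max_ge) auto
    qed
    then show ?L by (auto simp: bdd_above_def)
  }
qed

text \<open>
  Dropping the first \<open>m\<close> summands shifts all later partial sums by one constant, so boundedness
  depends on \<open>Z i\<close> for \<open>i \<ge> m\<close> only.
\<close>

lemma (in prob_space) AE_bdd_above_partial_sums_0_1:
  fixes Z :: "nat \<Rightarrow> 'a \<Rightarrow> real"
  assumes indep: "indep_vars (\<lambda>_. borel) Z UNIV"
  shows "(AE \<omega> in M. bdd_above (range (\<lambda>n. \<Sum>i<n. Z i \<omega>))) \<or>
         (AE \<omega> in M. \<not> bdd_above (range (\<lambda>n. \<Sum>i<n. Z i \<omega>)))"
proof -
  define A where "A i = sigma_sets (space M) {Z i -` B \<inter> space M | B. B \<in> sets borel}" for i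
  define U where "U = {\<omega> \<in> space M. bdd_above (range (\<lambda>n. \<Sum>i<n. Z i \<omega>))}"
  have indA: "indep_sets A UNIV"
    using indep unfolding indep_vars_def A_def by simp
  have [measurable]: "Z i \<in> borel_measurable M" for i
    using indep by (auto simp: indep_vars_def2)
  have sigA: "sigma_algebra (space M) (A i)" for i
    unfolding A_def by (rule sigma_algebra_sigma_sets) auto
  have "U \<in> tail_events A"
    unfolding tail_events_def
  proof
    fix m
    \<comment> \<open>\<open>F\<close> is the space \<open>M\<close> with the sigma-algebra generated by the \<open>Z i\<close> with \<open>i \<ge> m\<close>.\<close>
    define G where "G = \<Union> (A ` {m..})"
    have G: "G \<subseteq> Pow (space M)"
      using sigA unfolding G_def sigma_algebra_def algebra_def ring_of_sets_def semiring_of_sets_def subset_class_def by blast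
    define F where "F = sigma (space M) G"
    have [simp]: "space F = space M" and sF: "sets F = sigma_sets (space M) G"
      using G by (auto simp: F_def)
    have Zm: "Z i \<in> borel_measurable F" if "m \<le> i" for i
    proof (rule measurableI)
      fix B :: "real set" assume "B \<in> sets borel"
      then have "Z i -` B \<inter> space M \<in> A i" unfolding A_def by (intro sigma_sets.Basic) blast
      then show "Z i -` B \<inter> space F \<in> sets F"
        unfolding sF using that by (auto simp: G_def intro: sigma_sets.Basic)
    qed simp
    have [measurable]: "(\<lambda>\<omega>. \<Sum>i=m..<n. Z i \<omega>) \<in> borel_measurable F" for n
      by (rule borel_measurable_sum) (simp add: Zm)
    have "{\<omega> \<in> space F. \<exists>K::nat. \<forall>n. (\<Sum>i=m..<n. Z i \<omega>) \<le> real K} \<in> sets F"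
      by measurable
    also have "{\<omega> \<in> space F. \<exists>K::nat. \<forall>n. (\<Sum>i=m..<n. Z i \<omega>) \<le> real K} = U"
      unfolding U_def by (subst bdd_above_partial_sums_iff_tail[of _ m]) simp
    finally show "U \<in> sigma_sets (space M) (\<Union> (A ` {m..}))"
      by (simp add: sF G_def)
  qed
  then have "prob U = 0 \<or> prob U = 1"
    by (rule kolmogorov_0_1_law[OF sigA indA])
  moreover have "U = {\<omega> \<in> space M. \<exists>K::nat. \<forall>n. (\<Sum>i=0..<n. Z i \<omega>) \<le> real K}"
    unfolding U_def by (subst bdd_above_partial_sums_iff_tail[of _ 0]) simp
  then have "U \<in> events" by simp
  ultimately have "(AE \<omega> in M. \<omega> \<notin> U) \<or> (AE \<omega> in M. \<omega> \<in> U)"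
    by (simp add: prob_eq_0 prob_eq_1)
  moreover have "(AE \<omega> in M. \<omega> \<notin> U) \<longleftrightarrow> (AE \<omega> in M. \<not> bdd_above (range (\<lambda>n. \<Sum>i<n. Z i \<omega>)))"
    "(AE \<omega> in M. \<omega> \<in> U) \<longleftrightarrow> (AE \<omega> in M. bdd_above (range (\<lambda>n. \<Sum>i<n. Z i \<omega>)))"
    by (intro AE_cong; simp add: U_def)+
  ultimately show ?thesis by blast
qed

text \<open>Used to number the signs from \<open>0\<close>, so that the tail events range over all of \<open>nat\<close>.\<close>

lemma (in prob_space) indep_vars_reindex_inj:
  assumes "inj_on f I" and "indep_vars N X (f ` I)"
  shows "indep_vars (\<lambda>i. N (f i)) (\<lambda>i. X (f i)) I"
  unfolding indep_vars_def2 indep_sets_def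
proof (intro conjI ballI allI impI)
  let ?G = "\<lambda>i. {X i -` A \<inter> space M | A. A \<in> sets (N i)}"
  show rv: "random_variable (N (f i)) (X (f i))" if "i \<in> I" for i
    using assms(2) that by (auto simp: indep_vars_def2)
  show "?G (f i) \<subseteq> events" if "i \<in> I" for i
    using rv[OF that] by (auto intro: measurable_sets)
  fix J A assume J: "J \<subseteq> I" "J \<noteq> {}" "finite J" and A: "A \<in> (\<Pi> j\<in>J. ?G (f j))"
  have inj: "inj_on f J" using assms(1) J(1) by (rule inj_on_subset)
  define B where "B = A \<circ> the_inv_into J f"
  have B: "B (f j) = A j" if "j \<in> J" for j
    using the_inv_into_f_f[OF inj that] by (simp add: B_def)
  have "B \<in> Pi (f ` J) ?G" using A B by (auto simp: Pi_iff)
  moreover have "indep_sets ?G (f ` I)" using assms(2) by (simp add: indep_vars_def2)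
  ultimately have "prob (\<Inter>j\<in>f ` J. B j) = (\<Prod>j\<in>f ` J. prob (B j))"
    using J by (intro indep_setsD) auto
  then show "prob (\<Inter>j\<in>J. A j) = (\<Prod>j\<in>J. prob (A j))"
    using B by (simp add: prod.reindex[OF inj])
qed

section \<open>A lower tail bound from four moments\<close>

text \<open>
  The polynomial \<open>(x - 1/12) * (2 - x) * (x + 2)\<^sup>2\<close> is positive only for \<open>x\<close> strictly between \<open>1/12\<close>
  and \<open>2\<close>, and there it is at most \<open>64\<close>. Its expectation involves only the first four moments and
  is at least \<open>1/2\<close>. Because its zero at \<open>-2\<close> is double, the polynomial stays nonpositive on the
  negative axis, so the bound concerns the upper tail alone.
\<close>

lemma (in prob_space) gaussian_like_moments_lower_tail:
  fixes X :: "'a \<Rightarrow> real"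
  assumes int: "\<And>k. integrable M (\<lambda>\<omega>. X \<omega> ^ k)"
    and m1: "expectation X = 0" and m2: "expectation (\<lambda>\<omega>. X \<omega> ^ 2) = 1"
    and m3: "expectation (\<lambda>\<omega>. X \<omega> ^ 3) = 0" and m4: "expectation (\<lambda>\<omega>. X \<omega> ^ 4) \<le> 3"
  shows "prob {\<omega> \<in> space M. 1/12 \<le> X \<omega>} \<ge> 1/128"
proof -
  let ?A = "{\<omega> \<in> space M. 1/12 \<le> X \<omega>}"
  define q :: "real \<Rightarrow> real" where "q x = (x - 1/12) * (2 - x) * (x + 2)\<^sup>2" for x
  have q: "q x = 8 * x + 4 * x^2 - 2 * x^3 - x^4 - (8 + 4 * x - 2 * x^2 - x^3) / 12" for x
    unfolding q_def by (simp add: field_simps power2_eq_square power3_eq_cube power4_eq_xxxx)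
  have i1: "integrable M X" using int[of 1] by simp
  then have [measurable]: "X \<in> borel_measurable M" by simp
  have qint: "integrable M (\<lambda>\<omega>. q (X \<omega>))"
    unfolding q using int i1 by simp
  have "expectation (\<lambda>\<omega>. q (X \<omega>)) = 4 - expectation (\<lambda>\<omega>. X \<omega> ^ 4) - 1/2"
    unfolding q using int i1 m1 m2 m3 by (simp add: prob_space)
  then have "1/2 \<le> expectation (\<lambda>\<omega>. q (X \<omega>))" using m4 by simp
  also have "\<dots> \<le> expectation (\<lambda>\<omega>. 64 * indicator ?A \<omega>)"
  proof (rule integral_mono[OF qint])
    fix \<omega> assume w: "\<omega> \<in> space M"
    let ?x = "X \<omega>"
    consider "?x < 1/12" | "1/12 \<le> ?x" "?x \<le> 2" | "2 < ?x" by linarith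
    then show "q ?x \<le> 64 * indicator ?A \<omega>"
    proof cases
      case 1
      then have "(?x - 1/12) * (2 - ?x) \<le> 0" by (intro mult_nonpos_nonneg) auto
      then have "q ?x \<le> 0" unfolding q_def by (intro mult_nonpos_nonneg[OF _ zero_le_power2])
      then show ?thesis by (auto simp: indicator_def)
    next
      case 2
      then have "(?x - 1/12) * (2 - ?x) \<le> 2 * 2" by (intro mult_mono) auto
      moreover have "(?x + 2)\<^sup>2 \<le> 4\<^sup>2" using 2 by (intro power_mono) auto
      ultimately have "q ?x \<le> (2 * 2) * 4\<^sup>2" unfolding q_def using 2 by (intro mult_mono) auto
      then show ?thesis using 2 w by simp
    next
      case 3
      then have "(?x - 1/12) * (2 - ?x) \<le> 0" by (intro mult_nonneg_nonpos) auto
      then have "q ?x \<le> 0" unfolding q_def by (intro mult_nonpos_nonneg[OF _ zero_le_power2])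
      then show ?thesis by (auto simp: indicator_def)
    qed
  qed (intro integrable_mult_right integrable_real_indicator; simp add: less_top[symmetric])
  also have "\<dots> = 64 * prob ?A" by (simp)
  finally show ?thesis by simp
qed

section \<open>Weighted sums of independent random signs\<close>

locale weighted_signs = prob_space M for M :: "'a measure" +
  fixes Y :: "nat \<Rightarrow> 'a \<Rightarrow> real" and b :: "nat \<Rightarrow> real"
  assumes indep_Y: "indep_vars (\<lambda>_. borel) Y UNIV"
    and prob_plus: "prob {\<omega> \<in> space M. Y i \<omega> = 1} = 1 / 2"
    and prob_minus: "prob {\<omega> \<in> space M. Y i \<omega> = -1} = 1 / 2"
begin

abbreviation S :: "nat \<Rightarrow> 'a \<Rightarrow> real" where
  "S n \<omega> \<equiv> \<Sum>i<n. Y i \<omega> * b i"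

lemma measurable_Y [measurable]: "Y i \<in> borel_measurable M"
  using indep_Y by (auto simp: indep_vars_def2)

lemma AE_sign: "AE \<omega> in M. Y i \<omega> = 1 \<or> Y i \<omega> = -1"
proof -
  have "prob ({\<omega> \<in> space M. Y i \<omega> = 1} \<union> {\<omega> \<in> space M. Y i \<omega> = -1}) = 1"
    by (subst finite_measure_Union) (auto simp: prob_plus prob_minus)
  also have "{\<omega> \<in> space M. Y i \<omega> = 1} \<union> {\<omega> \<in> space M. Y i \<omega> = -1} =
      {\<omega> \<in> space M. Y i \<omega> = 1 \<or> Y i \<omega> = -1}" by auto
  finally show ?thesis by (subst (asm) prob_Collect_eq_1) auto
qed

lemma expectation_sign_power: "expectation (\<lambda>\<omega>. Y i \<omega> ^ k) = (if even k then 1 else 0)"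
proof -
  let ?P = "{\<omega> \<in> space M. Y i \<omega> = 1}" and ?N = "{\<omega> \<in> space M. Y i \<omega> = -1}"
  have "expectation (\<lambda>\<omega>. Y i \<omega> ^ k) =
      expectation (\<lambda>\<omega>. indicator ?P \<omega> + (-1) ^ k * indicator ?N \<omega>)"
    using AE_sign[of i] by (intro integral_cong_AE) (auto simp: indicator_def)
  also have "\<dots> = 1/2 + (-1) ^ k * (1/2)"
    by (subst Bochner_Integration.integral_add)
       (auto simp: prob_plus prob_minus less_top[symmetric] intro!: integrable_real_indicator)
  finally show ?thesis by auto
qed

text \<open>Boundedness of \<open>S n\<close> is what makes all the moments below exist.\<close>

lemma AE_abs_S_le: "AE \<omega> in M. \<bar>S n \<omega>\<bar> \<le> (\<Sum>i<n. \<bar>b i\<bar>)"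
proof -
  have "AE \<omega> in M. \<forall>i. Y i \<omega> = 1 \<or> Y i \<omega> = -1"
    using AE_sign by (simp add: AE_all_countable)
  then show ?thesis
  proof eventually_elim
    case (elim \<omega>)
    have "\<bar>Y i \<omega>\<bar> = 1" for i using elim by (metis abs_1 abs_minus_cancel)
    then show ?case
      using sum_abs[of "\<lambda>i. Y i \<omega> * b i" "{..<n}"] by (simp add: abs_mult)
  qed
qed

lemma integrable_S_power_mult_Y_power: "integrable M (\<lambda>\<omega>. S n \<omega> ^ j * Y i \<omega> ^ k)"
proof (rule integrable_const_bound)
  show "AE \<omega> in M. norm (S n \<omega> ^ j * Y i \<omega> ^ k) \<le> (\<Sum>i<n. \<bar>b i\<bar>) ^ j"
    using AE_abs_S_le[of n] AE_sign[of i]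
  proof eventually_elim
    case (elim \<omega>)
    have "\<bar>Y i \<omega>\<bar> = 1" using elim by auto
    then show ?case using elim by (simp add: abs_mult power_abs power_mono)
  qed
qed measurable

lemma integrable_S_power: "integrable M (\<lambda>\<omega>. S n \<omega> ^ j)"
  using integrable_S_power_mult_Y_power[of n j 0 0] by simp

lemma expectation_S_power_mult_Y_power:
  "expectation (\<lambda>\<omega>. S n \<omega> ^ j * Y n \<omega> ^ k) =
     expectation (\<lambda>\<omega>. S n \<omega> ^ j) * (if even k then 1 else 0)"
proof -
  define f where "f i = (if i = n then (\<lambda>y. y) else (\<lambda>y::real. y * b i))" for i
  have "indep_vars (\<lambda>_. borel) (\<lambda>i \<omega>. f i (Y i \<omega>)) (insert n {..<n})"
    by (rule indep_vars_compose2[OF indep_vars_subset[OF indep_Y]]) (auto simp: f_def)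
  then have "indep_var borel (\<lambda>\<omega>. f n (Y n \<omega>)) borel (\<lambda>\<omega>. \<Sum>i<n. f i (Y i \<omega>))"
    by (intro indep_vars_sum) auto
  moreover have "(\<Sum>i<n. f i (Y i \<omega>)) = S n \<omega>" for \<omega>
    by (intro sum.cong) (auto simp: f_def)
  ultimately have "indep_var borel (Y n) borel (S n)"
    by (simp add: f_def)
  then have "indep_var borel ((\<lambda>x. x ^ k) \<circ> Y n) borel ((\<lambda>x. x ^ j) \<circ> S n)"
    by (rule indep_var_compose) auto
  then have "indep_var borel (\<lambda>\<omega>. Y n \<omega> ^ k) borel (\<lambda>\<omega>. S n \<omega> ^ j)"
    by (simp add: comp_def)
  moreover have "integrable M (\<lambda>\<omega>. Y n \<omega> ^ k)"
    using integrable_S_power_mult_Y_power[of 0 0 n k] by simp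
  ultimately show ?thesis
    using indep_var_lebesgue_integral[of "\<lambda>\<omega>. Y n \<omega> ^ k" "\<lambda>\<omega>. S n \<omega> ^ j"]
      integrable_S_power[of n j] by (simp add: expectation_sign_power mult.commute)
qed

text \<open>
  Expand the powers of \<open>S n + Y n * b n\<close>: by independence, the terms with an odd power of \<open>Y n\<close>
  vanish. In the fourth moment the term \<open>(b n) ^ 4\<close> is enlarged to \<open>3 * (b n) ^ 4\<close>, which completes
  the square.
\<close>

lemma S_moments:
  "expectation (S n) = 0"
  "expectation (\<lambda>\<omega>. S n \<omega> ^ 2) = (\<Sum>i<n. (b i)\<^sup>2)"
  "expectation (\<lambda>\<omega>. S n \<omega> ^ 3) = 0"
  "expectation (\<lambda>\<omega>. S n \<omega> ^ 4) \<le> 3 * (\<Sum>i<n. (b i)\<^sup>2)\<^sup>2"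
proof (induction n)
  case 0
  case 1 show ?case by simp
  case 2 show ?case by simp
  case 3 show ?case by simp
  case 4 show ?case by simp
next
  case (Suc n)
  let ?m = "\<lambda>j k. expectation (\<lambda>\<omega>. S n \<omega> ^ j * Y n \<omega> ^ k)"
  note int = integrable_S_power_mult_Y_power[of n _ n]
  note mean_simps = Bochner_Integration.integral_add integral_mult_right_zero
    integrable_mult_right Bochner_Integration.integrable_add
  have "expectation (S (Suc n)) = expectation (\<lambda>\<omega>. S n \<omega> ^ 1 * Y n \<omega> ^ 0 + b n * (S n \<omega> ^ 0 * Y n \<omega> ^ 1))"
    by (simp add: mult.commute)
  also have "\<dots> = ?m 1 0 + b n * ?m 0 1"
    using int by (simp only: mean_simps)
  finally show "expectation (S (Suc n)) = 0"
    unfolding expectation_S_power_mult_Y_power using Suc by simp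
  have "expectation (\<lambda>\<omega>. S (Suc n) \<omega> ^ 2) = expectation (\<lambda>\<omega>. S n \<omega> ^ 2 * Y n \<omega> ^ 0
      + (2 * b n) * (S n \<omega> ^ 1 * Y n \<omega> ^ 1) + (b n)\<^sup>2 * (S n \<omega> ^ 0 * Y n \<omega> ^ 2))"
    by (intro Bochner_Integration.integral_cong refl) (simp add: algebra_simps power2_eq_square)
  also have "\<dots> = ?m 2 0 + (2 * b n) * ?m 1 1 + (b n)\<^sup>2 * ?m 0 2"
    using int by (simp only: mean_simps)
  finally show "expectation (\<lambda>\<omega>. S (Suc n) \<omega> ^ 2) = (\<Sum>i<Suc n. (b i)\<^sup>2)"
    unfolding expectation_S_power_mult_Y_power using Suc by (simp add: prob_space)
  have "expectation (\<lambda>\<omega>. S (Suc n) \<omega> ^ 3) = expectation (\<lambda>\<omega>. S n \<omega> ^ 3 * Y n \<omega> ^ 0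
      + (3 * b n) * (S n \<omega> ^ 2 * Y n \<omega> ^ 1) + (3 * (b n)\<^sup>2) * (S n \<omega> ^ 1 * Y n \<omega> ^ 2)
      + (b n)^3 * (S n \<omega> ^ 0 * Y n \<omega> ^ 3))"
    by (intro Bochner_Integration.integral_cong refl)
       (simp add: algebra_simps power2_eq_square power3_eq_cube)
  also have "\<dots> = ?m 3 0 + (3 * b n) * ?m 2 1 + (3 * (b n)\<^sup>2) * ?m 1 2 + (b n)^3 * ?m 0 3"
    using int by (simp only: mean_simps)
  finally show "expectation (\<lambda>\<omega>. S (Suc n) \<omega> ^ 3) = 0"
    unfolding expectation_S_power_mult_Y_power using Suc by simp
  have "expectation (\<lambda>\<omega>. S (Suc n) \<omega> ^ 4) = expectation (\<lambda>\<omega>. S n \<omega> ^ 4 * Y n \<omega> ^ 0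
      + (4 * b n) * (S n \<omega> ^ 3 * Y n \<omega> ^ 1) + (6 * (b n)\<^sup>2) * (S n \<omega> ^ 2 * Y n \<omega> ^ 2)
      + (4 * (b n)^3) * (S n \<omega> ^ 1 * Y n \<omega> ^ 3) + (b n)^4 * (S n \<omega> ^ 0 * Y n \<omega> ^ 4))"
    by (intro Bochner_Integration.integral_cong refl)
       (simp add: algebra_simps power2_eq_square power3_eq_cube power4_eq_xxxx)
  also have "\<dots> = ?m 4 0 + (4 * b n) * ?m 3 1 + (6 * (b n)\<^sup>2) * ?m 2 2 + (4 * (b n)^3) * ?m 1 3
      + (b n)^4 * ?m 0 4"
    using int by (simp only: mean_simps)
  also have "\<dots> = expectation (\<lambda>\<omega>. S n \<omega> ^ 4) + 6 * (b n)\<^sup>2 * (\<Sum>i<n. (b i)\<^sup>2) + (b n)^4"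
    unfolding expectation_S_power_mult_Y_power using Suc by (simp add: prob_space)
  also have "\<dots> \<le> 3 * (\<Sum>i<n. (b i)\<^sup>2)\<^sup>2 + 6 * (b n)\<^sup>2 * (\<Sum>i<n. (b i)\<^sup>2) + 3 * (b n)^4"
    using Suc by (intro add_mono) auto
  also have "\<dots> = 3 * (\<Sum>i<Suc n. (b i)\<^sup>2)\<^sup>2"
    by (simp add: algebra_simps power2_eq_square power4_eq_xxxx)
  finally show "expectation (\<lambda>\<omega>. S (Suc n) \<omega> ^ 4) \<le> 3 * (\<Sum>i<Suc n. (b i)\<^sup>2)\<^sup>2" .
qed

lemma prob_S_ge:
  assumes pos: "(\<Sum>i<n. (b i)\<^sup>2) > 0"
  shows "prob {\<omega> \<in> space M. sqrt (\<Sum>i<n. (b i)\<^sup>2) / 12 \<le> S n \<omega>} \<ge> 1/128"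
proof -
  define s where "s = sqrt (\<Sum>i<n. (b i)\<^sup>2)"
  have s: "s > 0" "s\<^sup>2 = (\<Sum>i<n. (b i)\<^sup>2)" using pos by (auto simp: s_def)
  have s4: "s ^ 4 = (\<Sum>i<n. (b i)\<^sup>2)\<^sup>2" using s(2) by (simp flip: s(2))
  have "prob {\<omega> \<in> space M. 1/12 \<le> S n \<omega> / s} \<ge> 1/128"
  proof (rule gaussian_like_moments_lower_tail)
    show "integrable M (\<lambda>\<omega>. (S n \<omega> / s) ^ k)" for k
      using integrable_S_power by (simp add: power_divide)
    show "expectation (\<lambda>\<omega>. (S n \<omega> / s) ^ 4) \<le> 3"
      using S_moments(4)[of n] pos by (simp add: power_divide s4 divide_le_eq)
  qed (use S_moments[of n] s pos in \<open>simp_all add: power_divide\<close>)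
  also have "{\<omega> \<in> space M. 1/12 \<le> S n \<omega> / s} = {\<omega> \<in> space M. s / 12 \<le> S n \<omega>}"
    using s by (auto simp: field_simps)
  finally show ?thesis by (simp add: s_def)
qed

text \<open>
  The walk exceeds any fixed level \<open>K\<close> with probability at least \<open>1/128\<close>, hence, by continuity
  of the measure from above, it exceeds all levels with at least this probability; the zero-one
  law raises it to \<open>1\<close>.
\<close>

lemma AE_unbounded_above:
  assumes div: "filterlim (\<lambda>n. \<Sum>i<n. (b i)\<^sup>2) at_top sequentially"
  shows "AE \<omega> in M. \<not> bdd_above (range (\<lambda>n. S n \<omega>))"
proof -
  define A where "A K = {\<omega> \<in> space M. \<exists>n. real K \<le> S n \<omega>}" for K :: nat
  have meas: "range A \<subseteq> events" unfolding A_def by auto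
  have "decseq A"
    unfolding A_def decseq_def using order_trans[OF of_nat_mono] by blast
  then have lim: "(\<lambda>K. prob (A K)) \<longlonglongrightarrow> prob (\<Inter>K. A K)"
    using meas by (intro finite_Lim_measure_decseq)
  have "prob (A K) \<ge> 1/128" for K
  proof -
    \<comment> \<open>The summand \<open>1\<close> makes the variance positive also for \<open>K = 0\<close>.\<close>
    have "eventually (\<lambda>n. (12 * real K + 1)\<^sup>2 \<le> (\<Sum>i<n. (b i)\<^sup>2)) sequentially"
      using div by (simp add: filterlim_at_top)
    then obtain n where n: "(12 * real K + 1)\<^sup>2 \<le> (\<Sum>i<n. (b i)\<^sup>2)"
      by (auto simp: eventually_sequentially)
    have "0 < (12 * real K + 1)\<^sup>2" by (intro zero_less_power) linarith
    then have "1/128 \<le> prob {\<omega> \<in> space M. sqrt (\<Sum>i<n. (b i)\<^sup>2) / 12 \<le> S n \<omega>}"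
      using n by (intro prob_S_ge) linarith
    also have "\<dots> \<le> prob (A K)"
    proof (rule finite_measure_mono)
      have "12 * real K + 1 \<le> sqrt (\<Sum>i<n. (b i)\<^sup>2)" using n by (rule real_le_rsqrt)
      then show "{\<omega> \<in> space M. sqrt (\<Sum>i<n. (b i)\<^sup>2) / 12 \<le> S n \<omega>} \<subseteq> A K"
        unfolding A_def by (intro Collect_mono conj_mono impI exI[of _ n]) auto
    qed (use meas in auto)
    finally show ?thesis .
  qed
  then have pos: "prob (\<Inter>K. A K) \<ge> 1/128"
    by (intro LIMSEQ_le_const[OF lim]) auto
  have "\<not> (AE \<omega> in M. bdd_above (range (\<lambda>n. S n \<omega>)))"
  proof
    assume "AE \<omega> in M. bdd_above (range (\<lambda>n. S n \<omega>))"
    then have "AE \<omega> in M. \<omega> \<notin> (\<Inter>K. A K)"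
    proof eventually_elim
      case (elim \<omega>)
      then obtain C where C: "\<And>n. S n \<omega> \<le> C" by (auto simp: bdd_above_def)
      obtain K :: nat where "C < real K" using reals_Archimedean2 by blast
      then have "\<omega> \<notin> A K" using C by (auto simp: A_def not_le intro: le_less_trans)
      then show ?case by blast
    qed
    then have "prob (\<Inter>K. A K) = 0" using meas by (subst prob_eq_0) auto
    then show False using pos by simp
  qed
  moreover have "indep_vars (\<lambda>_. borel) (\<lambda>i \<omega>. Y i \<omega> * b i) UNIV"
    by (rule indep_vars_compose2[OF indep_Y]) auto
  ultimately show ?thesis
    using AE_bdd_above_partial_sums_0_1 by blast
qed

lemma AE_unbounded_below:
  assumes div: "filterlim (\<lambda>n. \<Sum>i<n. (b i)\<^sup>2) at_top sequentially"
  shows "AE \<omega> in M. \<not> bdd_below (range (\<lambda>n. S n \<omega>))"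
proof -
  interpret neg: weighted_signs M "\<lambda>i \<omega>. - Y i \<omega>" b
  proof
    show "indep_vars (\<lambda>_. borel) (\<lambda>i \<omega>. - Y i \<omega>) UNIV"
      by (rule indep_vars_compose2[OF indep_Y]) auto
    show "prob {\<omega> \<in> space M. - Y i \<omega> = 1} = 1/2" for i
      using prob_minus[of i] by (simp add: minus_equation_iff[of _ 1] eq_commute[of "-1"])
    show "prob {\<omega> \<in> space M. - Y i \<omega> = -1} = 1/2" for i
      using prob_plus[of i] by simp
  qed
  from neg.AE_unbounded_above[OF div] show ?thesis
  proof eventually_elim
    case (elim \<omega>)
    then show ?case
      by (auto simp: sum_negf bdd_above_def bdd_below_def) (metis minus_le_iff neg_le_iff_le)
  qed
qed

end

section \<open>Small steps and oscillation give density\<close>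

text \<open>
  Given \<open>y\<close>, wait until all steps are shorter than \<open>e\<close> and the sequence is below \<open>y\<close>. At the first
  later time when it is at least \<open>y\<close>, it has jumped over \<open>y\<close> by less than \<open>e\<close>.
\<close>

lemma closure_range_eq_UNIV_if_small_steps:
  fixes x :: "nat \<Rightarrow> real"
  assumes up: "\<not> bdd_above (range x)" and down: "\<not> bdd_below (range x)"
    and steps: "(\<lambda>n. x (Suc n) - x n) \<longlonglongrightarrow> 0"
  shows "closure (range x) = UNIV"
proof -
  have "\<exists>n. dist (x n) y < e" if "e > 0" for y e
  proof -
    obtain N where N: "\<And>n. n \<ge> N \<Longrightarrow> \<bar>x (Suc n) - x n\<bar> < e"
      using LIMSEQ_D[OF steps \<open>e > 0\<close>] by auto
    \<comment> \<open>Finitely many terms cannot account for the unboundedness, so every level is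
      passed at arbitrarily late times, in both directions.\<close>
    have "\<exists>n\<ge>m. x n < y" for m
    proof (rule ccontr)
      assume "\<not> ?thesis"
      then have "min y (Min (x ` {..m})) \<le> x n" for n
        by (cases "n \<le> m") (auto simp: min_le_iff_disj not_less)
      then show False using down by (auto simp: bdd_below_def)
    qed
    then obtain m where m: "m \<ge> N" "x m < y" by blast
    have "\<exists>n\<ge>m. y \<le> x n"
    proof (rule ccontr)
      assume "\<not> ?thesis"
      then have "x n \<le> max y (Max (x ` {..m}))" for n
        by (cases "n \<le> m") (auto simp: le_max_iff_disj not_le, meson less_asym less_imp_le)
      then show False using up by (auto simp: bdd_above_def)
    qed
    then obtain n where n: "n \<ge> m" "y \<le> x n" and least: "\<And>k. k < n \<Longrightarrow> \<not> (k \<ge> m \<and> y \<le> x k)"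
      using exists_least_iff[of "\<lambda>n. n \<ge> m \<and> y \<le> x n"] by blast
    have "n \<noteq> m" using m n by auto
    then obtain k where k: "n = Suc k" "k \<ge> m" using n by (cases n) auto
    then have "x k < y" using least[of k] by auto
    then show ?thesis using N[of k] k m n by (intro exI[of _ n]) (auto simp: dist_real_def)
  qed
  then show ?thesis by (auto simp: closure_approachable)
qed

section \<open>Topological recurrence\<close>

theorem corollary12:
  fixes M :: "'w measure"
    and \<epsilon> :: "nat \<Rightarrow> 'w \<Rightarrow> real"
    and a :: "nat \<Rightarrow> real"
  assumes "prob_space M"
    and "rademacher_sequence M \<epsilon>"
    and "\<And>n. n \<ge> 1 \<Longrightarrow> a n \<ge> 0"
    and "filterlim (\<lambda>N. \<Sum>n=1..N. (a n)\<^sup>2) at_top sequentially"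
    and "a \<longlonglongrightarrow> 0"
  shows "topologically_recurrent M (rademacher_walk \<epsilon> a)"
proof -
  interpret prob_space M by fact
  have ind: "indep_vars (\<lambda>_. borel) \<epsilon> {1..}"
    using assms(2) by (simp add: rademacher_sequence_def)
  interpret weighted_signs M "\<lambda>i. \<epsilon> (Suc i)" "\<lambda>i. a (Suc i)"
  proof
    show "indep_vars (\<lambda>_. borel) (\<lambda>i. \<epsilon> (Suc i)) UNIV"
      by (rule indep_vars_reindex_inj[OF _ indep_vars_subset[OF ind]]) auto
  qed (use assms(2) in \<open>simp_all add: rademacher_sequence_def\<close>)
  have shift: "(\<Sum>k=1..n. f k) = (\<Sum>i<n. f (Suc i))" for f :: "nat \<Rightarrow> real" and n
    by (simp add: sum.atLeast_Suc_atMost_Suc_shift lessThan_atLeast0 atLeastLessThanSuc_atLeastAtMost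
        flip: sum.shift_bounds_Suc_ivl)
  have walk: "rademacher_walk \<epsilon> a n \<omega> = S n \<omega>" for n \<omega>
    unfolding rademacher_walk_def by (rule shift)
  have div: "filterlim (\<lambda>n. \<Sum>i<n. (a (Suc i))\<^sup>2) at_top sequentially"
    using assms(4) by (simp only: shift)
  have "AE \<omega> in M. \<forall>i. \<epsilon> (Suc i) \<omega> = 1 \<or> \<epsilon> (Suc i) \<omega> = -1"
    using AE_sign by (simp add: AE_all_countable)
  then have "AE \<omega> in M. closure (range (\<lambda>n. S n \<omega>)) = UNIV"
    using AE_unbounded_above[OF div] AE_unbounded_below[OF div]
  proof eventually_elim
    case (elim \<omega>)
    have "\<bar>\<epsilon> (Suc i) \<omega>\<bar> = 1" for i using elim(1) by (metis abs_1 abs_minus_cancel)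
    then have "(\<lambda>n. \<bar>\<epsilon> (Suc n) \<omega> * a (Suc n)\<bar>) \<longlonglongrightarrow> 0"
      using tendsto_rabs[OF LIMSEQ_Suc[OF assms(5)]] by (simp add: abs_mult)
    then have "(\<lambda>n. S (Suc n) \<omega> - S n \<omega>) \<longlonglongrightarrow> 0"
      by (simp add: tendsto_rabs_zero_iff)
    with elim show ?case
      by (intro closure_range_eq_UNIV_if_small_steps) auto
  qed
  then show ?thesis
    by (simp add: topologically_recurrent_def walk)
qed

end
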